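(* For every integer $k$ there is a $c_k>0$ such that for every $\alpha\in(1-c_k,1]$ there exists a $\beta>0$ such that the following holds. Let $H$ be a set of $k$ closed halfspaces in $\mathbb{R}^d$, let $P$ be a monotone property of $H$-convex sets, and let $\mathcal{B}$ be a finite family of $H$-convex sets in $\mathbb{R}^d$. If at least $\alpha\binom{|\mathcal{B}|}{2}$ of the pairs in $\mathcal{B}$ are $P$-intersecting, then there exists a $P$-intersecting subfamily $\mathcal{B}'\subseteq\mathcal{B}$ of size at least $\beta|\mathcal{B}|$.
   Context: Let $H=\{H_1,\dots,H_k\}$ be a set of $k$ closed halfspaces in $\mathbb{R}^d$. An $H$-convex set $B$ in $\mathbb{R}^d$ is an intersection of $k$ halfspaces $H_1^B,\dots,H_k^B$ such that for each $i$ the halfspace $H_i^B$ is a translate of $H_i$. Intersections of nonempty finite families of $H$-convex sets are $H$-convex. A property $P$ of $H$-convex sets (a class of $H$-convex sets) is monotone if $B\in P$ and $B\subseteq C$ imply $C\in P$ for all $H$-convex sets $B,C$. A family of $H$-convex sets is $P$-intersecting if the intersection of its members has property $P$.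
   Formalization: The family 𝓑 is assumed to have at least two members; for a single-member family and a property P not containing that member, the condition on pairs holds vacuously and the claim fails, and for an empty family the intersection is not H-convex. *)

theory Defs
  imports "Jordan_Normal_Form.Matrix"
begin

text \<open>
  The constants in the theorem must not depend on the dimension \<open>d\<close>, so \<open>d\<close> is quantified
  inside the statement and \<open>d\<close>-dimensional space is the carrier \<open>carrier_vec d\<close> of real
  vectors of dimension \<open>d\<close>, not a type.
\<close>

definition closed_halfspace :: "nat \<Rightarrow> real vec set \<Rightarrow> bool" where
  "closed_halfspace d S \<longleftrightarrow>
     (\<exists>a \<in> carrier_vec d. \<exists>b. a \<noteq> 0\<^sub>v d \<and> S = {x \<in> carrier_vec d. a \<bullet> x \<le> b})"

definition translate_of :: "nat \<Rightarrow> real vec set \<Rightarrow> real vec set \<Rightarrow> bool" where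
  "translate_of d S T \<longleftrightarrow> (\<exists>v \<in> carrier_vec d. T = (\<lambda>x. v + x) ` S)"

text \<open>
  The factor \<open>carrier_vec d\<close> matters only for \<open>H = {}\<close>, where the intersection of no
  halfspaces is the whole space. The empty set is \<open>H\<close>-convex if it arises as such an
  intersection.
\<close>

definition H_convex :: "nat \<Rightarrow> real vec set set \<Rightarrow> real vec set \<Rightarrow> bool" where
  "H_convex d H B \<longleftrightarrow>
     (\<exists>T. (\<forall>h \<in> H. translate_of d h (T h)) \<and> B = carrier_vec d \<inter> (\<Inter>h \<in> H. T h))"

text \<open>Properties are classes \<open>P\<close> of \<open>H\<close>-convex sets.\<close>

definition monotone_property :: "nat \<Rightarrow> real vec set set \<Rightarrow> real vec set set \<Rightarrow> bool" where
  "monotone_property d H P \<longleftrightarrow>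
     (\<forall>B \<in> P. H_convex d H B) \<and>
     (\<forall>B C. H_convex d H B \<longrightarrow> H_convex d H C \<longrightarrow> B \<in> P \<longrightarrow> B \<subseteq> C \<longrightarrow> C \<in> P)"

text \<open>
  For the empty family the intersection below is the universe of the type \<open>real vec\<close>, which is
  not \<open>H\<close>-convex; thus the empty family is never \<open>P\<close>-intersecting.
\<close>

definition P_intersecting :: "real vec set set \<Rightarrow> real vec set set \<Rightarrow> bool" where
  "P_intersecting P F \<longleftrightarrow> \<Inter>F \<in> P"

end

theory Submission
  imports Defs "HOL-Library.Ramsey"
begin

text \<open>
  A monotone property sees an intersection only through its bounding thresholds, one for each of the
  \<open>k\<close> directions. If \<open>B \<inter> C\<close> has \<open>P\<close>, then so has the intersection of \<^emph>\<open>all\<close> members of the family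
  that contain \<open>B \<inter> C\<close>. It therefore suffices to find a \<open>P\<close>-intersecting pair that is good in the sense
  that a positive fraction of the family contains \<open>B \<inter> C\<close>.

  Good pairs are abundant for a reason that has nothing to do with \<open>P\<close>. The translates of one
  halfspace form a chain, so each direction preorders the family. In a sequence of \<open>N\<close> members,
  with \<open>N\<close> a Ramsey number depending on \<open>k\<close> only, some three members are monotone in every
  direction, increasing or decreasing according to the direction (\<open>ex_monotone_subset\<close>); the middle one
  of the three then contains the intersection of the outer two (\<open>ex_between\<close>). Averaging over all
  sequences of length \<open>N\<close> turns this single occurrence into a positive proportion, at least \<open>1 / N\<^sup>3\<close>, of
  all triples \<open>(B, C, D)\<close> satisfying \<open>B \<inter> C \<subseteq> D\<close> (\<open>card_triples_ge\<close>).

  If no \<open>P\<close>-intersecting pair were good, those triples would have to come from the few pairs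
  that are not \<open>P\<close>-intersecting, of which there is only a proportion of \<open>1 - \<alpha>\<close>, or from pairs that
  contribute few triples each. For \<open>1 - \<alpha> < 1 / (3N\<^sup>3)\<close> and \<open>\<beta> = 1 / (3N\<^sup>3)\<close> these are too few
  (\<open>ex_rich_pair\<close>). In particular \<open>\<beta>\<close> can be chosen independently of \<open>\<alpha>\<close>.
\<close>

section \<open>Triples that are monotone in every direction\<close>

text \<open>
  Ramsey's theorem for graphs is applied once for each relation: the pairs \<open>a < b\<close> with \<open>r h a b\<close> are
  the edges, and on an independent set totality yields the reversed relation. Each application
  shrinks the set, so the size \<open>m\<close> still needed has to be arbitrary in the induction.
\<close>

lemma ex_monotone_subset:
  fixes k m :: nat
  shows "\<exists>N. \<forall>(H :: 'h set) (r :: 'h \<Rightarrow> nat \<Rightarrow> nat \<Rightarrow> bool) I.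
           finite H \<and> card H = k \<and> (\<forall>h\<in>H. \<forall>a b. r h a b \<or> r h b a) \<and> finite I \<and> N \<le> card I \<longrightarrow>
           (\<exists>J\<subseteq>I. card J = m \<and>
             (\<forall>h\<in>H. (\<forall>a\<in>J. \<forall>b\<in>J. a < b \<longrightarrow> r h a b) \<or> (\<forall>a\<in>J. \<forall>b\<in>J. a < b \<longrightarrow> r h b a)))"
proof (induction k arbitrary: m)
  case 0
  have "\<exists>J\<subseteq>I. card J = m" if "m \<le> card I" for I :: "nat set"
    using obtain_subset_with_card_n[OF that] by metis
  then show ?case
    by (intro exI[of _ m]) auto
next
  case (Suc k)
  obtain M where M: "\<And>(V :: nat set) E. finite V \<Longrightarrow> M \<le> card V \<Longrightarrow>
      \<exists>R\<subseteq>V. card R = m \<and> clique R E \<or> card R = m \<and> indep R E"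
    using ramsey2[of m m, where ?'a = nat] by blast
  obtain N where N: "\<forall>(H :: 'h set) (r :: 'h \<Rightarrow> nat \<Rightarrow> nat \<Rightarrow> bool) I.
      finite H \<and> card H = k \<and> (\<forall>h\<in>H. \<forall>a b. r h a b \<or> r h b a) \<and> finite I \<and> N \<le> card I \<longrightarrow>
      (\<exists>J\<subseteq>I. card J = M \<and>
        (\<forall>h\<in>H. (\<forall>a\<in>J. \<forall>b\<in>J. a < b \<longrightarrow> r h a b) \<or> (\<forall>a\<in>J. \<forall>b\<in>J. a < b \<longrightarrow> r h b a)))"
    using Suc.IH[of M] ..
  show ?case
  proof (intro exI[of _ N] allI impI, elim conjE)
    fix H :: "'h set" and r :: "'h \<Rightarrow> nat \<Rightarrow> nat \<Rightarrow> bool" and I :: "nat set"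
    assume H: "finite H" "card H = Suc k" and total: "\<forall>h\<in>H. \<forall>a b. r h a b \<or> r h b a"
      and I: "finite I" "N \<le> card I"
    obtain h H' where H': "H = insert h H'" "h \<notin> H'" "card H' = k" "finite H'"
      using H by (metis card_Suc_eq_finite)
    obtain J where J: "J \<subseteq> I" "card J = M"
      "\<forall>g\<in>H'. (\<forall>a\<in>J. \<forall>b\<in>J. a < b \<longrightarrow> r g a b) \<or> (\<forall>a\<in>J. \<forall>b\<in>J. a < b \<longrightarrow> r g b a)"
      using N[rule_format, of H' r I] H' total I by auto
    define E where "E = {{a, b} | a b. a < b \<and> r h a b}"
    have E: "{a, b} \<in> E \<longleftrightarrow> r h a b" if "a < b" for a b
      using that by (auto simp: E_def doubleton_eq_iff)
    obtain R where R: "R \<subseteq> J" "card R = m" "clique R E \<or> indep R E"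
      using M[of J E] J I finite_subset by blast
    have "(\<forall>a\<in>R. \<forall>b\<in>R. a < b \<longrightarrow> r h a b) \<or> (\<forall>a\<in>R. \<forall>b\<in>R. a < b \<longrightarrow> r h b a)"
      using R(3)
    proof
      assume "clique R E"
      then show ?thesis
        using E unfolding clique_def by (metis less_irrefl)
    next
      assume "indep R E"
      then have "\<forall>a\<in>R. \<forall>b\<in>R. a < b \<longrightarrow> \<not> r h a b"
        using E unfolding indep_def by (metis less_irrefl)
      then show ?thesis
        using total H' by blast
    qed
    moreover have "\<forall>g\<in>H'. (\<forall>a\<in>R. \<forall>b\<in>R. a < b \<longrightarrow> r g a b) \<or> (\<forall>a\<in>R. \<forall>b\<in>R. a < b \<longrightarrow> r g b a)"
      using J(3) R(1) by (meson subsetD)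
    ultimately show "\<exists>J\<subseteq>I. card J = m \<and>
        (\<forall>h\<in>H. (\<forall>a\<in>J. \<forall>b\<in>J. a < b \<longrightarrow> r h a b) \<or> (\<forall>a\<in>J. \<forall>b\<in>J. a < b \<longrightarrow> r h b a))"
      using R J(1) H'(1) by (intro exI[of _ R]) auto
  qed
qed

text \<open>
  The middle \<open>c\<close> of a monotone triple \<open>a < c < b\<close> lies above \<open>a\<close> for every increasing relation and
  above \<open>b\<close> for every decreasing one.
\<close>

lemma ex_between:
  fixes k :: nat
  shows "\<exists>N>0. \<forall>(H :: 'h set) (r :: 'h \<Rightarrow> nat \<Rightarrow> nat \<Rightarrow> bool).
           finite H \<and> card H = k \<and> (\<forall>h\<in>H. \<forall>a b. r h a b \<or> r h b a) \<longrightarrow>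
           (\<exists>a<N. \<exists>b<N. \<exists>c<N. a < c \<and> c < b \<and> (\<forall>h\<in>H. r h a c \<or> r h b c))"
proof -
  obtain N where N: "\<forall>(H :: 'h set) (r :: 'h \<Rightarrow> nat \<Rightarrow> nat \<Rightarrow> bool) I.
      finite H \<and> card H = k \<and> (\<forall>h\<in>H. \<forall>a b. r h a b \<or> r h b a) \<and> finite I \<and> N \<le> card I \<longrightarrow>
      (\<exists>J\<subseteq>I. card J = 3 \<and>
        (\<forall>h\<in>H. (\<forall>a\<in>J. \<forall>b\<in>J. a < b \<longrightarrow> r h a b) \<or> (\<forall>a\<in>J. \<forall>b\<in>J. a < b \<longrightarrow> r h b a)))"
    using ex_monotone_subset[of k 3, where ?'h = 'h] ..
  show ?thesis
  proof (rule exI[of _ "Suc N"], intro conjI allI impI zero_less_Suc, elim conjE)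
    fix H :: "'h set" and r :: "'h \<Rightarrow> nat \<Rightarrow> nat \<Rightarrow> bool"
    assume H: "finite H" "card H = k" "\<forall>h\<in>H. \<forall>a b. r h a b \<or> r h b a"
    obtain J where J: "J \<subseteq> {..<Suc N}" "card J = 3"
      "\<forall>h\<in>H. (\<forall>a\<in>J. \<forall>b\<in>J. a < b \<longrightarrow> r h a b) \<or> (\<forall>a\<in>J. \<forall>b\<in>J. a < b \<longrightarrow> r h b a)"
      using N[rule_format, of H r "{..<Suc N}"] H by auto
    obtain x y z where "J = {x, y, z}" "x \<noteq> y" "y \<noteq> z" "x \<noteq> z"
      using J(2) by (metis card_3_iff)
    then obtain a c b where abc: "a \<in> J" "b \<in> J" "c \<in> J" "a < c" "c < b"
      by (metis insertCI linorder_neqE_nat)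
    have "\<forall>h\<in>H. r h a c \<or> r h b c"
      using J(3) abc by blast
    then show "\<exists>a<Suc N. \<exists>b<Suc N. \<exists>c<Suc N. a < c \<and> c < b \<and> (\<forall>h\<in>H. r h a c \<or> r h b c)"
      using abc J(1) by blast
  qed
qed

section \<open>From one triple per sequence to a positive proportion of triples\<close>

text \<open>
  A function on \<open>N\<close> positions whose values at three given distinct positions form a triple in \<open>R\<close> is
  determined by that triple and by its values at the other \<open>N - 3\<close> positions.
\<close>

lemma card_PiE_triple_le:
  fixes V :: "'a set" and R :: "('a \<times> 'a \<times> 'a) set"
  assumes "finite V" "finite R" "a < N" "b < N" "c < N" "distinct [a, b, c]"
  shows "card {f \<in> {..<N} \<rightarrow>\<^sub>E V. (f a, f b, f c) \<in> R} \<le> card R * card V ^ (N - 3)"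
proof -
  define J where "J = {..<N} - {a, b, c}"
  define g where "g f = ((f a, f b, f c), restrict f J)" for f :: "nat \<Rightarrow> 'a"
  have "inj_on g ({..<N} \<rightarrow>\<^sub>E V)"
  proof (rule inj_onI)
    fix f f'
    assume f: "f \<in> {..<N} \<rightarrow>\<^sub>E V" and f': "f' \<in> {..<N} \<rightarrow>\<^sub>E V" and eq: "g f = g f'"
    show "f = f'"
    proof (rule PiE_ext[OF f f'])
      fix x assume x: "x \<in> {..<N}"
      show "f x = f' x"
      proof (cases "x \<in> J")
        case True
        have "restrict f J x = restrict f' J x"
          using eq by (simp add: g_def)
        with True show ?thesis
          by simp
      next
        case False
        then show ?thesis
          using eq x by (auto simp: g_def J_def)
      qed
    qed
  qed
  then have "inj_on g {f \<in> {..<N} \<rightarrow>\<^sub>E V. (f a, f b, f c) \<in> R}"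
    by (rule inj_on_subset) auto
  moreover have "g ` {f \<in> {..<N} \<rightarrow>\<^sub>E V. (f a, f b, f c) \<in> R} \<subseteq> R \<times> (J \<rightarrow>\<^sub>E V)"
  proof (intro image_subsetI)
    fix f assume f: "f \<in> {f \<in> {..<N} \<rightarrow>\<^sub>E V. (f a, f b, f c) \<in> R}"
    then have "restrict f J \<in> J \<rightarrow>\<^sub>E V"
      by (intro restrict_PiE_iff[THEN iffD2]) (auto simp: J_def)
    then show "g f \<in> R \<times> (J \<rightarrow>\<^sub>E V)"
      using f by (simp add: g_def)
  qed
  moreover have "finite (R \<times> (J \<rightarrow>\<^sub>E V))"
    using assms by (auto simp: J_def intro!: finite_PiE)
  ultimately have "card {f \<in> {..<N} \<rightarrow>\<^sub>E V. (f a, f b, f c) \<in> R} \<le> card (R \<times> (J \<rightarrow>\<^sub>E V))"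
    by (rule card_inj_on_le)
  also have "card J = N - 3"
    using assms by (simp add: J_def card_Diff_subset)
  then have "card (R \<times> (J \<rightarrow>\<^sub>E V)) = card R * card V ^ (N - 3)"
    by (simp add: card_cartesian_product card_PiE J_def)
  finally show ?thesis .
qed

text \<open>
  A union bound over the at most \<open>N\<^sup>3\<close> choices of three positions. Functions stand for sequences, so
  repeated values are allowed and the count stays exact.
\<close>

lemma card_triples_ge:
  fixes V :: "'a set" and R :: "('a \<times> 'a \<times> 'a) set"
  assumes "finite V" "V \<noteq> {}" "finite R"
    and ex: "\<And>f. f \<in> {..<N} \<rightarrow>\<^sub>E V \<Longrightarrow>
      \<exists>a<N. \<exists>b<N. \<exists>c<N. distinct [a, b, c] \<and> (f a, f b, f c) \<in> R"
  shows "card V ^ 3 \<le> N ^ 3 * card R"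
proof -
  define D where "D = {(a, b, c). a < N \<and> b < N \<and> c < N \<and> distinct [a, b, c]}"
  define F where "F = (\<lambda>(a, b, c). {f \<in> {..<N} \<rightarrow>\<^sub>E V. (f a, f b, f c) \<in> R})"
  have D_sub: "D \<subseteq> {..<N} \<times> {..<N} \<times> {..<N}"
    by (auto simp: D_def)
  then have finD: "finite D"
    by (rule finite_subset) auto
  have "card D \<le> card ({..<N} \<times> {..<N} \<times> {..<N})"
    using D_sub by (intro card_mono) auto
  then have cardD: "card D \<le> N ^ 3"
    by (simp add: card_cartesian_product power3_eq_cube)
  have cover: "({..<N} \<rightarrow>\<^sub>E V) \<subseteq> (\<Union>p\<in>D. F p)"
    using ex by (fastforce simp: D_def F_def)
  have finU: "finite (\<Union>p\<in>D. F p)"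
    using finD assms(1)
    by (intro finite_UN_I finite_subset[OF _ finite_PiE[of "{..<N}" "\<lambda>_. V"]]) (auto simp: F_def)
  have "card V ^ N = card ({..<N} \<rightarrow>\<^sub>E V)"
    by (simp add: card_PiE)
  also have "\<dots> \<le> card (\<Union>p\<in>D. F p)"
    using cover finU by (rule card_mono[rotated])
  also have "\<dots> \<le> (\<Sum>p\<in>D. card (F p))"
    by (rule card_UN_le[OF finD])
  also have "\<dots> \<le> (\<Sum>p\<in>D. card R * card V ^ (N - 3))"
  proof (rule sum_mono)
    fix p assume "p \<in> D"
    then show "card (F p) \<le> card R * card V ^ (N - 3)"
      using card_PiE_triple_le[OF assms(1,3)] by (auto simp: D_def F_def)
  qed
  also have "\<dots> \<le> N ^ 3 * (card R * card V ^ (N - 3))"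
    using cardD by (simp add: mult_le_mono1)
  finally have le: "card V ^ N \<le> N ^ 3 * card R * card V ^ (N - 3)"
    by (simp add: mult.assoc)
  obtain v where "v \<in> V"
    using assms(2) by blast
  then have "(\<lambda>x\<in>{..<N}. v) \<in> {..<N} \<rightarrow>\<^sub>E V"
    by auto
  then obtain a b c where "a < N" "b < N" "c < N" "distinct [a, b, c]"
    using ex by blast
  then have "N \<ge> 3"
    by auto
  then have "card V ^ N = card V ^ 3 * card V ^ (N - 3)"
    by (simp flip: power_add)
  then show ?thesis
    using le assms(1,2) by (simp add: card_gt_0_iff)
qed

section \<open>A rich pair in a dense graph\<close>

lemma card_ordered_pairs:
  assumes "finite F" "\<And>S. S \<in> F \<Longrightarrow> card S = 2"
  shows "card {(x, y). x \<noteq> y \<and> {x, y} \<in> F} = 2 * card F"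
proof -
  define G where "G S = {(x, y). x \<noteq> y \<and> {x, y} = S}" for S :: "'a set"
  have G: "finite (G S) \<and> card (G S) = 2" if S: "S \<in> F" for S
  proof -
    obtain x y where xy: "S = {x, y}" "x \<noteq> y"
      using assms(2)[OF S] by (metis card_2_iff)
    then have "G S = {(x, y), (y, x)}"
      by (auto simp: G_def doubleton_eq_iff)
    then show ?thesis
      using xy by simp
  qed
  have "{(x, y). x \<noteq> y \<and> {x, y} \<in> F} = (\<Union>S\<in>F. G S)"
    by (auto simp: G_def)
  also have "card \<dots> = (\<Sum>S\<in>F. card (G S))"
    using assms(1) G by (intro card_UN_disjoint) (auto simp: G_def)
  also have "\<dots> = 2 * card F"
    using G by simp
  finally show ?thesis .
qed

text \<open>
  Suppose that every edge has fewer than \<open>n / (3M)\<close> members above it, where \<open>n = card V\<close>. The ordered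
  pairs that are not edges, diagonal included, number at most \<open>(1 - \<alpha>) n\<^sup>2 + n\<close> and carry at most
  \<open>n\<close> triples each, so there are at most \<open>((1 - \<alpha>) + 1 / n + 1 / (3M)) n\<^sup>3\<close> triples. The first two
  summands are smaller than \<open>1 / (3M)\<close>, the second one because an edge has one of its own ends above
  it, which forces \<open>n > 3M\<close>. This contradicts the lower bound \<open>n\<^sup>3 / M\<close> on the number of triples.
\<close>

lemma ex_rich_pair:
  fixes V :: "'a set" and up :: "'a \<Rightarrow> 'a \<Rightarrow> 'a set" and F :: "'a set set" and M :: nat
  assumes V: "finite V" "2 \<le> card V"
    and up: "\<And>x z. x \<in> V \<Longrightarrow> z \<in> V \<Longrightarrow> up x z \<subseteq> V \<and> x \<in> up x z"
    and many: "card V ^ 3 \<le> M * card {(x, z, y). x \<in> V \<and> z \<in> V \<and> y \<in> up x z}"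
    and F: "\<And>S. S \<in> F \<Longrightarrow> S \<subseteq> V \<and> card S = 2"
    and dense: "\<alpha> * real (card V choose 2) \<le> real (card F)" and \<alpha>: "1 - 1 / (3 * real M) < \<alpha>" "\<alpha> \<le> 1"
  obtains (rich) x z where "x \<in> V" "z \<in> V" "{x, z} \<in> F"
    "real (card V) / (3 * real M) \<le> real (card (up x z))"
proof (rule ccontr)
  assume "\<not> thesis"
  then have poor: "real (card (up x z)) < real (card V) / (3 * real M)"
    if "x \<in> V" "z \<in> V" "{x, z} \<in> F" for x z
    using rich that \<open>\<not> thesis\<close> by (meson not_le)
  define n where "n = real (card V)"
  define E where "E = {(x, z). x \<noteq> z \<and> {x, z} \<in> F}"
  have n: "n \<ge> 2"
    using V by (simp add: n_def)
  have M: "M \<ge> 1"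
    using many V by (cases M) auto
  have finF: "finite F"
    using F V(1) by (metis Pow_iff finite_Pow_iff finite_subset subsetI)
  have EV: "E \<subseteq> V \<times> V"
    using F by (fastforce simp: E_def)
  have finE: "finite E"
    using EV V(1) by (meson finite_SigmaI finite_subset)
  have fin_up: "finite (up x z)" if "x \<in> V" "z \<in> V" for x z
    using up[OF that] V(1) finite_subset by blast
  have cardE: "card E = 2 * card F"
    unfolding E_def using finF F by (intro card_ordered_pairs) auto
  have "real (card V choose 2) = n * (n - 1) / 2"
    using V(2) by (simp add: n_def choose_two real_of_nat_div of_nat_diff)
  then have "\<alpha> * n * (n - 1) = 2 * (\<alpha> * real (card V choose 2))"
    by simp
  also have "\<dots> \<le> real (card E)"
    using dense cardE by simp
  finally have E_ge: "\<alpha> * n * (n - 1) \<le> real (card E)" .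
  have "1 / (3 * real M) \<le> 1 / 3"
    using M by (simp add: field_simps)
  then have "\<alpha> > 0"
    using \<alpha> by linarith
  then have "real (card E) > 0"
    using n by (intro less_le_trans[OF _ E_ge]) simp
  then have "E \<noteq> {}"
    by auto
  then obtain x z where xz: "(x, z) \<in> E"
    by auto
  then have xzV: "x \<in> V" "z \<in> V" "{x, z} \<in> F"
    using EV by (auto simp: E_def)
  have "card (up x z) > 0"
    using up[OF xzV(1,2)] fin_up[OF xzV(1,2)] by (auto simp: card_gt_0_iff)
  then have large: "1 < n / (3 * real M)"
    using poor[OF xzV] by (simp add: n_def)
  have "{(x, z, y). x \<in> V \<and> z \<in> V \<and> y \<in> up x z} =
      (\<lambda>((x, z), y). (x, z, y)) ` (SIGMA (x, z):V \<times> V. up x z)"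
    by force
  moreover have "inj_on (\<lambda>((x, z), y). (x, z, y)) (SIGMA (x, z):V \<times> V. up x z)"
    by (auto simp: inj_on_def)
  ultimately have "card {(x, z, y). x \<in> V \<and> z \<in> V \<and> y \<in> up x z} = card (SIGMA (x, z):V \<times> V. up x z)"
    by (simp add: card_image)
  also have "\<dots> = (\<Sum>p\<in>V \<times> V. card (case p of (x, z) \<Rightarrow> up x z))"
    using V(1) fin_up by (intro card_SigmaI) auto
  finally have "real (card {(x, z, y). x \<in> V \<and> z \<in> V \<and> y \<in> up x z}) =
      (\<Sum>p\<in>V \<times> V. real (card (case p of (x, z) \<Rightarrow> up x z)))"
    by simp
  also have "\<dots> = (\<Sum>p\<in>V \<times> V - E. real (card (case p of (x, z) \<Rightarrow> up x z))) +
      (\<Sum>p\<in>E. real (card (case p of (x, z) \<Rightarrow> up x z)))"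
    using V(1) EV by (intro sum.subset_diff) auto
  also have "\<dots> \<le> (\<Sum>p\<in>V \<times> V - E. n) + (\<Sum>p\<in>E. n / (3 * real M))"
  proof (intro add_mono sum_mono)
    fix p assume "p \<in> V \<times> V - E"
    then show "real (card (case p of (x, z) \<Rightarrow> up x z)) \<le> n"
      using up V(1) by (auto simp: n_def intro!: card_mono)
  next
    fix p assume "p \<in> E"
    then show "real (card (case p of (x, z) \<Rightarrow> up x z)) \<le> n / (3 * real M)"
      using EV poor by (auto simp: n_def E_def intro!: less_imp_le)
  qed
  also have "\<dots> = (n * n - real (card E)) * n + real (card E) * (n / (3 * real M))"
    using EV finE V(1) card_mono[OF _ EV]
    by (simp add: card_Diff_subset card_cartesian_product n_def of_nat_diff)
  also have "\<dots> \<le> (n * n - \<alpha> * n * (n - 1)) * n + n * n * (n / (3 * real M))"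
  proof (intro add_mono mult_right_mono)
    have "card E \<le> card (V \<times> V)"
      using EV V(1) by (intro card_mono) auto
    then show "real (card E) \<le> n * n"
      by (simp add: n_def card_cartesian_product flip: of_nat_mult)
  qed (use E_ge n in auto)
  finally have upper: "real (card {(x, z, y). x \<in> V \<and> z \<in> V \<and> y \<in> up x z})
      \<le> (n * n - \<alpha> * n * (n - 1)) * n + n * n * (n / (3 * real M))" .
  define t where "t = 1 / (3 * real M)"
  have t: "t > 0" "3 * t * real M = 1" "1 - \<alpha> < t" "1 < n * t"
    using M \<alpha> large by (auto simp: t_def)
  have "real (card V ^ 3) \<le> real (M * card {(x, z, y). x \<in> V \<and> z \<in> V \<and> y \<in> up x z})"
    using many of_nat_le_iff by blast
  then have "n ^ 3 \<le> real M * real (card {(x, z, y). x \<in> V \<and> z \<in> V \<and> y \<in> up x z})"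
    by (simp add: n_def)
  also have "\<dots> \<le> real M * ((n * n - \<alpha> * n * (n - 1)) * n + n * n * (n * t))"
    using upper by (intro mult_left_mono) (simp_all add: t_def)
  finally have "n ^ 3 \<le> real M * (n ^ 2 * ((1 - \<alpha>) * n + \<alpha> + n * t))"
    by (simp add: power2_eq_square algebra_simps)
  also have "\<dots> < real M * (n ^ 2 * (t * n + n * t + n * t))"
  proof (intro mult_strict_left_mono add_strict_right_mono add_strict_mono)
    show "(1 - \<alpha>) * n < t * n"
      using t n by simp
    show "\<alpha> < n * t"
      using t \<alpha> by linarith
  qed (use M n in auto)
  also have "\<dots> = n ^ 3 * (3 * t * real M)"
    by (simp add: power2_eq_square power3_eq_cube algebra_simps)
  finally show False
    using t by simp
qed

section \<open>Translates of halfspaces and their intersections\<close>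

lemma translate_of_halfspaceE:
  assumes "a \<in> carrier_vec d" "translate_of d {x \<in> carrier_vec d. a \<bullet> x \<le> b} T"
  obtains b' where "T = {x \<in> carrier_vec d. a \<bullet> x \<le> b'}"
proof -
  obtain v where v: "v \<in> carrier_vec d" "T = (\<lambda>x. v + x) ` {x \<in> carrier_vec d. a \<bullet> x \<le> b}"
    using assms by (auto simp: translate_of_def)
  have "x \<in> T" if x: "x \<in> carrier_vec d" "a \<bullet> x \<le> b + a \<bullet> v" for x
  proof -
    have "x = v + (x - v)"
      using x v by (intro eq_vecI) auto
    moreover have "a \<bullet> (x - v) \<le> b"
      using x v assms(1) by (simp add: scalar_prod_minus_distrib)
    ultimately show ?thesis
      using x v by (metis (mono_tags, lifting) image_eqI mem_Collect_eq minus_carrier_vec)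
  qed
  moreover have "T \<subseteq> {x \<in> carrier_vec d. a \<bullet> x \<le> b + a \<bullet> v}"
    using v assms(1) by (auto simp: scalar_prod_add_distrib)
  ultimately have "T = {x \<in> carrier_vec d. a \<bullet> x \<le> b + a \<bullet> v}"
    by auto
  then show thesis
    using that by blast
qed

lemma translates_comparable:
  assumes "closed_halfspace d h" "translate_of d h S" "translate_of d h T"
  shows "S \<subseteq> T \<or> T \<subseteq> S"
proof -
  obtain a b where a: "a \<in> carrier_vec d" and h: "h = {x \<in> carrier_vec d. a \<bullet> x \<le> b}"
    using assms(1) by (auto simp: closed_halfspace_def)
  obtain s where s: "S = {x \<in> carrier_vec d. a \<bullet> x \<le> s}"
    using assms(2) unfolding h by (rule translate_of_halfspaceE[OF a])
  obtain t where t: "T = {x \<in> carrier_vec d. a \<bullet> x \<le> t}"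
    using assms(3) unfolding h by (rule translate_of_halfspaceE[OF a])
  show ?thesis
    unfolding s t by (cases "s \<le> t") auto
qed

lemma H_convex_translates:
  assumes "\<forall>B\<in>F. H_convex d H B"
  obtains T where "\<And>B h. B \<in> F \<Longrightarrow> h \<in> H \<Longrightarrow> translate_of d h (T B h)"
    and "\<And>B. B \<in> F \<Longrightarrow> B = carrier_vec d \<inter> (\<Inter>h\<in>H. T B h)"
proof -
  have "\<exists>T. \<forall>B\<in>F. (\<forall>h\<in>H. translate_of d h (T B h)) \<and> B = carrier_vec d \<inter> (\<Inter>h\<in>H. T B h)"
    using assms unfolding H_convex_def by (rule bchoice)
  then obtain T where "\<forall>B\<in>F. (\<forall>h\<in>H. translate_of d h (T B h)) \<and>
      B = carrier_vec d \<inter> (\<Inter>h\<in>H. T B h)" ..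
  then show thesis
    by (intro that[of T]) simp_all
qed

text \<open>
  In each direction the finitely many translates form a chain, so that their intersection is one of
  them.
\<close>

lemma H_convex_Inter:
  assumes "\<forall>h\<in>H. closed_halfspace d h" "finite F" "F \<noteq> {}" "\<forall>B\<in>F. H_convex d H B"
  shows "H_convex d H (\<Inter>F)"
proof -
  obtain T where T: "\<And>B h. B \<in> F \<Longrightarrow> h \<in> H \<Longrightarrow> translate_of d h (T B h)"
      and B: "\<And>B. B \<in> F \<Longrightarrow> B = carrier_vec d \<inter> (\<Inter>h\<in>H. T B h)"
    using H_convex_translates[of F d H] assms(4) by blast
  have "translate_of d h (\<Inter>B\<in>F. T B h)" if h: "h \<in> H" for h
  proof -
    have "subset.chain UNIV ((\<lambda>B. T B h) ` F)"
      unfolding subset_chain_def using translates_comparable assms(1) T h by blast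
    then have "(\<Inter>B\<in>F. T B h) \<in> (\<lambda>B. T B h) ` F"
      using assms(2,3) by (intro Inter_in_chain) auto
    then show ?thesis
      using T h by auto
  qed
  moreover have "\<Inter>F = (\<Inter>B\<in>F. carrier_vec d \<inter> (\<Inter>h\<in>H. T B h))"
    using B by auto
  then have "\<Inter>F = carrier_vec d \<inter> (\<Inter>h\<in>H. \<Inter>B\<in>F. T B h)"
    using assms(3) by auto
  ultimately show ?thesis
    unfolding H_convex_def by (intro exI[of _ "\<lambda>h. \<Inter>B\<in>F. T B h"]) blast
qed

section \<open>A \<open>P\<close>-intersecting subfamily of positive proportion\<close>

theorem theorem2p7:
  fixes k :: nat
  shows "\<exists>c::real. c > 0 \<and> (\<forall>\<alpha>::real. 1 - c < \<alpha> \<and> \<alpha> \<le> 1 \<longrightarrow>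
    (\<exists>\<beta>::real. \<beta> > 0 \<and>
      (\<forall>(d::nat) (H :: real vec set set) (P :: real vec set set) (\<B> :: real vec set set).
        finite H \<and> card H = k \<and> (\<forall>h \<in> H. closed_halfspace d h) \<and>
        monotone_property d H P \<and>
        finite \<B> \<and> card \<B> \<ge> 2 \<and> (\<forall>B \<in> \<B>. H_convex d H B) \<and>
        real (card {S. S \<subseteq> \<B> \<and> card S = 2 \<and> P_intersecting P S}) \<ge> \<alpha> * real (card \<B> choose 2)
        \<longrightarrow> (\<exists>\<B>' \<subseteq> \<B>. P_intersecting P \<B>' \<and> real (card \<B>') \<ge> \<beta> * real (card \<B>)))))"
proof -
  obtain N where N': "N > 0 \<and> (\<forall>(H :: real vec set set) (r :: real vec set \<Rightarrow> nat \<Rightarrow> nat \<Rightarrow> bool).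
      finite H \<and> card H = k \<and> (\<forall>h\<in>H. \<forall>a b. r h a b \<or> r h b a) \<longrightarrow>
      (\<exists>a<N. \<exists>b<N. \<exists>c<N. a < c \<and> c < b \<and> (\<forall>h\<in>H. r h a c \<or> r h b c)))"
    using ex_between[of k, where ?'h = "real vec set"] ..
  then have "N > 0"
    by (rule conjunct1)
  note N = N'[THEN conjunct2, rule_format]
  \<comment> \<open>One constant serves both as \<open>c\<close> and as \<open>\<beta>\<close>.\<close>
  define \<beta> where "\<beta> = 1 / (3 * real (N ^ 3))"
  have "\<beta> > 0"
    using \<open>N > 0\<close> by (simp add: \<beta>_def)
  have main: "\<exists>\<B>'\<subseteq>\<B>. P_intersecting P \<B>' \<and> real (card \<B>') \<ge> \<beta> * real (card \<B>)"
    if \<alpha>: "1 - \<beta> < \<alpha>" "\<alpha> \<le> 1" and H: "finite H" "card H = k" "\<forall>h\<in>H. closed_halfspace d h"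
      and P: "monotone_property d H P"
      and \<B>: "finite \<B>" "card \<B> \<ge> 2" "\<forall>B\<in>\<B>. H_convex d H B"
      and dense: "real (card {S. S \<subseteq> \<B> \<and> card S = 2 \<and> P_intersecting P S}) \<ge>
        \<alpha> * real (card \<B> choose 2)"
    for \<alpha> d H P \<B>
  proof -
    obtain T where T: "\<And>B h. B \<in> \<B> \<Longrightarrow> h \<in> H \<Longrightarrow> translate_of d h (T B h)"
      and B_eq: "\<And>B. B \<in> \<B> \<Longrightarrow> B = carrier_vec d \<inter> (\<Inter>h\<in>H. T B h)"
      using H_convex_translates[of \<B> d H] \<B>(3) by blast
    define up where "up B C = {D \<in> \<B>. B \<inter> C \<subseteq> D}" for B C
    define R where "R = {(B, C, D). B \<in> \<B> \<and> C \<in> \<B> \<and> D \<in> up B C}"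
    have "R \<subseteq> \<B> \<times> \<B> \<times> \<B>"
      by (auto simp: R_def up_def)
    then have finR: "finite R"
      using \<B>(1) by (meson finite_SigmaI finite_subset)
    have many: "card \<B> ^ 3 \<le> N ^ 3 * card R"
    proof (rule card_triples_ge[OF \<B>(1) _ finR])
      fix f :: "nat \<Rightarrow> real vec set"
      assume f: "f \<in> {..<N} \<rightarrow>\<^sub>E \<B>"
      \<comment> \<open>The relation must be total on all of \<open>nat\<close>, so positions beyond \<open>N\<close> are reduced modulo \<open>N\<close>.\<close>
      define r where "r h i j \<longleftrightarrow> T (f (i mod N)) h \<subseteq> T (f (j mod N)) h" for h i j
      have mem: "f (i mod N) \<in> \<B>" for i
        using f \<open>N > 0\<close> by auto
      have "\<forall>h\<in>H. \<forall>i j. r h i j \<or> r h j i"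
        unfolding r_def using translates_comparable H(3) T mem by blast
      then obtain a b c where abc: "a < N" "b < N" "c < N" "a < c" "c < b"
          and r: "\<forall>h\<in>H. r h a c \<or> r h b c"
        using N[of H r] H(1,2) by auto
      have fV: "f a \<in> \<B>" "f b \<in> \<B>" "f c \<in> \<B>"
        using f abc by auto
      have sub: "\<forall>h\<in>H. T (f a) h \<subseteq> T (f c) h \<or> T (f b) h \<subseteq> T (f c) h"
        using r abc by (simp add: r_def)
      have "f a \<inter> f b \<subseteq> f c"
      proof
        fix x assume "x \<in> f a \<inter> f b"
        then have "x \<in> carrier_vec d \<inter> (\<Inter>h\<in>H. T (f a) h)" "x \<in> carrier_vec d \<inter> (\<Inter>h\<in>H. T (f b) h)"
          using B_eq fV by blast+
        then have "x \<in> carrier_vec d \<inter> (\<Inter>h\<in>H. T (f c) h)"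
          using sub by blast
        then show "x \<in> f c"
          using B_eq fV by blast
      qed
      then have "(f a, f b, f c) \<in> R"
        using fV by (simp add: R_def up_def)
      then show "\<exists>a<N. \<exists>b<N. \<exists>c<N. distinct [a, b, c] \<and> (f a, f b, f c) \<in> R"
        using abc by (intro exI[of _ a] exI[of _ b] exI[of _ c] conjI) auto
    qed (use \<B> in auto)
    obtain B C where BC: "B \<in> \<B>" "C \<in> \<B>" "{B, C} \<in> {S. S \<subseteq> \<B> \<and> card S = 2 \<and> P_intersecting P S}"
        and rich: "real (card \<B>) / (3 * real (N ^ 3)) \<le> real (card (up B C))"
    proof (rule ex_rich_pair[of \<B> up "N ^ 3", OF \<B>(1,2)])
      show "card \<B> ^ 3 \<le> N ^ 3 * card {(x, z, y). x \<in> \<B> \<and> z \<in> \<B> \<and> y \<in> up x z}"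
        using many by (simp add: R_def)
      show "1 - 1 / (3 * real (N ^ 3)) < \<alpha>"
        using \<alpha>(1) by (simp add: \<beta>_def)
    qed (use dense \<alpha>(2) in \<open>auto simp: up_def\<close>)
    have up: "up B C \<subseteq> \<B>" "B \<in> up B C" "B \<inter> C \<subseteq> \<Inter>(up B C)"
      using BC by (auto simp: up_def)
    have "H_convex d H (\<Inter>(up B C))"
      using H(3) \<B>(1,3) up(1,2) finite_subset by (intro H_convex_Inter) blast+
    moreover have "B \<inter> C \<in> P"
      using BC by (simp add: P_intersecting_def)
    ultimately have "P_intersecting P (up B C)"
      using P up(3) unfolding monotone_property_def P_intersecting_def by blast
    then show ?thesis
      using up(1) rich by (intro exI[of _ "up B C"]) (simp add: \<beta>_def)
  qed
  show ?thesis
  proof (intro exI[of _ \<beta>] conjI allI impI \<open>\<beta> > 0\<close>; elim conjE)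
  qed (rule main)
qed

end
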